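(* Let $L>0$. For each integer $N>2$ let $h=\frac{L}{N+1}$ and let $A_h'$ be the $N\times N$ tridiagonal matrix with all diagonal entries equal to $-\frac{2}{h^2}$, all sub-diagonal and super-diagonal entries equal to $\frac{1}{h^2}$, and all other entries zero. Then the scheme is stable: there exists a constant $K\in\mathbb{R}$, independent of $N$ (equivalently of $h$), such that for every $N>2$ the solution operator $E_h=(A_h')^{-1}$ satisfies $$\|E_h\|_2\le K ,$$ where $\|\cdot\|_2$ denotes the spectral norm.
   Context: The scheme is the central difference scheme $\frac{u(x+h)-2u(x)+u(x-h)}{h^2}=1$ for $u''=1$ on $(0,L)$ with $u(0)=u(L)=0$. For the symmetric matrix $E_h$ the spectral norm equals the spectral radius, $\|E_h\|_2=\max_m|\lambda_m(E_h)|$. *)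

theory Defs
  imports
    "Jordan_Normal_Form.Gauss_Jordan_Elimination"
    "HOL-Analysis.L2_Norm"
begin

definition euclidean_norm :: "real vec \<Rightarrow> real" where
  "euclidean_norm v = L2_set (vec_index v) {..<dim_vec v}"

text \<open>
  The spectral norm is the operator norm induced by the Euclidean norm.  The supremum is over the
  closed unit ball, so the set is never empty; \<open>bdd_above_spectral_norm\<close> shows that it is
  bounded, and hence that the supremum in the type of real numbers is a genuine one.
\<close>

definition spectral_norm :: "real mat \<Rightarrow> real" where
  "spectral_norm A =
     (SUP v\<in>{v \<in> carrier_vec (dim_col A). euclidean_norm v \<le> 1}. euclidean_norm (A *\<^sub>v v))"

lemma bdd_above_spectral_norm:
  "bdd_above ((\<lambda>v. euclidean_norm (A *\<^sub>v v)) `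
     {v \<in> carrier_vec (dim_col A). euclidean_norm v \<le> 1})"
proof (rule bdd_aboveI2)
  fix v assume "v \<in> {v \<in> carrier_vec (dim_col A). euclidean_norm v \<le> 1}"
  then have dim: "dim_vec v = dim_col A" and nv: "euclidean_norm v \<le> 1"
    by auto
  have entry: "\<bar>v $ j\<bar> \<le> 1" if "j < dim_col A" for j
  proof -
    have "\<bar>v $ j\<bar> \<le> L2_set (\<lambda>j. \<bar>v $ j\<bar>) {..<dim_vec v}"
      using that dim by (intro member_le_L2_set) auto
    also have "\<dots> = euclidean_norm v"
      by (simp add: euclidean_norm_def L2_set_def)
    finally show ?thesis using nv by simp
  qed
  have "euclidean_norm (A *\<^sub>v v) \<le> (\<Sum>i<dim_row A. \<bar>(A *\<^sub>v v) $ i\<bar>)"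
    using L2_set_le_sum_abs[of "vec_index (A *\<^sub>v v)" "{..<dim_row A}"]
    by (simp add: euclidean_norm_def)
  also have "\<dots> \<le> (\<Sum>i<dim_row A. \<Sum>j<dim_col A. \<bar>A $$ (i, j)\<bar>)"
  proof (rule sum_mono)
    fix i assume "i \<in> {..<dim_row A}"
    then have "(A *\<^sub>v v) $ i = (\<Sum>j<dim_col A. A $$ (i, j) * v $ j)"
      using dim by (simp add: scalar_prod_def lessThan_atLeast0)
    also have "\<bar>\<dots>\<bar> \<le> (\<Sum>j<dim_col A. \<bar>A $$ (i, j) * v $ j\<bar>)"
      by (rule sum_abs)
    also have "\<dots> \<le> (\<Sum>j<dim_col A. \<bar>A $$ (i, j)\<bar>)"
      using entry by (intro sum_mono) (simp add: abs_mult mult_left_le)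
    finally show "\<bar>(A *\<^sub>v v) $ i\<bar> \<le> (\<Sum>j<dim_col A. \<bar>A $$ (i, j)\<bar>)" .
  qed
  finally show "euclidean_norm (A *\<^sub>v v) \<le> (\<Sum>i<dim_row A. \<Sum>j<dim_col A. \<bar>A $$ (i, j)\<bar>)" .
qed

text \<open>
  The \<open>i\<close>-th row (counted from 0) is the central difference quotient for the second derivative
  at the grid point \<open>(i + 1) h\<close>; the boundary values, being zero, contribute no entries.
\<close>

definition central_difference_mat :: "real \<Rightarrow> nat \<Rightarrow> real mat" where
  "central_difference_mat h N = mat N N (\<lambda>(i, j).
     if i = j then - 2 / h\<^sup>2 else if i = Suc j \<or> j = Suc i then 1 / h\<^sup>2 else 0)"

end

theory Submission
  imports Defs "Jordan_Normal_Form.Determinant" "HOL-Analysis.Convex"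
begin

text \<open>
  The bound is an energy estimate.  Summation by parts turns \<open>-\<langle>v, A v\<rangle>\<close>, for the difference matrix
  \<open>A\<close> with step \<open>h = L / (N + 1)\<close>, into \<open>1 / h\<^sup>2\<close> times the sum of the squared increments of \<open>v\<close>
  extended by its zero boundary values.  A discrete Poincare inequality (telescoping and
  Cauchy-Schwarz) bounds \<open>\<parallel>v\<parallel>\<^sup>2\<close> by \<open>(N + 1)\<^sup>2\<close> times the same sum.  The two factors combine to
  \<open>(N + 1)\<^sup>2 h\<^sup>2 = L\<^sup>2\<close>, in which \<open>N\<close> has disappeared, so that
  \<open>\<parallel>v\<parallel>\<^sup>2 \<le> - L\<^sup>2 \<langle>v, A v\<rangle> \<le> L\<^sup>2 \<parallel>v\<parallel> \<parallel>A v\<parallel>\<close> and therefore \<open>\<parallel>v\<parallel> \<le> L\<^sup>2 \<parallel>A v\<parallel>\<close>.  This coercivity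
  (\<open>euclidean_norm_le_central_difference\<close>) makes \<open>A\<close> injective, hence invertible, and, read for
  \<open>v = E w\<close> with \<open>E\<close> the inverse, says that \<open>E\<close> has norm at most \<open>L\<^sup>2\<close>.
\<close>

lemma summation_by_parts_second_difference:
  fixes f :: "nat \<Rightarrow> real"
  shows "(\<Sum>k<n. f (Suc k) * (f (Suc (Suc k)) - 2 * f (Suc k) + f k)) =
    f (Suc n) * (f (Suc n) - f n) - f 0 * (f 1 - f 0) - (\<Sum>k\<le>n. (f (Suc k) - f k)\<^sup>2)"
  by (induction n) (simp_all add: algebra_simps power2_eq_square)

lemma sum_increments_squared_ge:
  fixes f :: "nat \<Rightarrow> real"
  assumes "f 0 = 0"
  shows "(f k)\<^sup>2 \<le> real k * (\<Sum>i<k. (f (Suc i) - f i)\<^sup>2)"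
proof -
  have "f k = (\<Sum>i<k. f (Suc i) - f i)"
    using assms sum_lessThan_telescope[of f k] by simp
  also have "\<dots>\<^sup>2 \<le> (\<Sum>i<k. (f (Suc i) - f i)\<^sup>2) * card {..<k}"
    by (rule sum_squared_le_sum_of_squares)
  finally show ?thesis by (simp add: mult.commute)
qed

text \<open>
  The crude bound of each \<open>(f k)\<^sup>2\<close> by \<open>n + 1\<close> times the full energy suffices: only the order
  \<open>(n + 1)\<^sup>2\<close> of the constant matters, since it is to cancel against the square of the step.
\<close>

lemma discrete_Poincare:
  fixes f :: "nat \<Rightarrow> real"
  assumes "f 0 = 0"
  shows "(\<Sum>k<n. (f (Suc k))\<^sup>2) \<le> (real n + 1)\<^sup>2 * (\<Sum>k\<le>n. (f (Suc k) - f k)\<^sup>2)"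
    (is "_ \<le> _ * ?D")
proof -
  have D: "?D \<ge> 0" by (simp add: sum_nonneg)
  have "(f (Suc k))\<^sup>2 \<le> (real n + 1) * ?D" if "k < n" for k
  proof -
    have "(f (Suc k))\<^sup>2 \<le> real (Suc k) * (\<Sum>i<Suc k. (f (Suc i) - f i)\<^sup>2)"
      using assms by (rule sum_increments_squared_ge)
    also have "\<dots> \<le> (real n + 1) * ?D"
      using that by (intro mult_mono sum_mono2 sum_nonneg) auto
    finally show ?thesis .
  qed
  then have "(\<Sum>k<n. (f (Suc k))\<^sup>2) \<le> real n * ((real n + 1) * ?D)"
    using sum_bounded_above[of "{..<n}" "\<lambda>k. (f (Suc k))\<^sup>2"] by simp
  also have "\<dots> \<le> (real n + 1) * ((real n + 1) * ?D)"
    using D by (intro mult_right_mono) auto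
  finally show ?thesis by (simp add: power2_eq_square mult.assoc)
qed

text \<open>
  The values of a grid function at the points \<open>0, h, 2 h, \<dots>\<close>: the entries of the vector belong to
  the interior points, and the boundary values are zero.
\<close>

definition zero_extension :: "real vec \<Rightarrow> nat \<Rightarrow> real" where
  "zero_extension v k = (if 0 < k \<and> k \<le> dim_vec v then v $ (k - 1) else 0)"

text \<open>
  With the boundary values in place, the first and the last row take the same form as the others.
\<close>

lemma central_difference_mat_mult_vec_index:
  assumes v: "v \<in> carrier_vec N" and i: "i < N"
  shows "(central_difference_mat h N *\<^sub>v v) $ i =
    (zero_extension v (Suc (Suc i)) - 2 * zero_extension v (Suc i) + zero_extension v i) / h\<^sup>2"
proof -
  let ?f = "zero_extension v"
  have "(central_difference_mat h N *\<^sub>v v) $ i =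
      (\<Sum>j<N. (if i = j then - 2 / h\<^sup>2 else if i = Suc j \<or> j = Suc i then 1 / h\<^sup>2 else 0) * v $ j)"
    using v i by (simp add: central_difference_mat_def scalar_prod_def lessThan_atLeast0)
  also have "\<dots> = (\<Sum>j<N. (if j = i then - 2 / h\<^sup>2 * ?f (Suc i) else 0)
      + (if j = Suc i then 1 / h\<^sup>2 * ?f (Suc (Suc i)) else 0)
      + (if Suc j = i then 1 / h\<^sup>2 * ?f i else 0))"
    using v by (intro sum.cong) (auto simp: zero_extension_def)
  also have "\<dots> = - 2 / h\<^sup>2 * ?f (Suc i) + 1 / h\<^sup>2 * ?f (Suc (Suc i)) + 1 / h\<^sup>2 * ?f i"
  proof -
    have "(\<Sum>j<N. if Suc j = i then 1 / h\<^sup>2 * ?f i else 0) = 1 / h\<^sup>2 * ?f i"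
      using i by (cases i) (simp_all add: zero_extension_def)
    moreover have "?f (Suc (Suc i)) = 0" if "\<not> Suc i < N"
      using v that by (simp add: zero_extension_def)
    ultimately show ?thesis
      using i by (simp add: sum.distrib)
  qed
  finally show ?thesis by (simp add: add_divide_distrib diff_divide_distrib)
qed

theorem euclidean_norm_le_central_difference:
  assumes L: "L > 0" and v: "v \<in> carrier_vec N"
  shows "euclidean_norm v \<le>
    L\<^sup>2 * euclidean_norm (central_difference_mat (L / (real N + 1)) N *\<^sub>v v)"
proof -
  define h where "h = L / (real N + 1)"
  define w where "w = central_difference_mat h N *\<^sub>v v"
  let ?f = "zero_extension v"
  let ?D = "\<Sum>k\<le>N. (?f (Suc k) - ?f k)\<^sup>2"
  have h: "h > 0" and hL: "(real N + 1)\<^sup>2 * h\<^sup>2 = L\<^sup>2"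
    using L by (simp_all add: h_def power_divide)
  have dimw: "dim_vec w = N"
    by (simp add: w_def central_difference_mat_def)
  have f: "?f 0 = 0" "?f (Suc N) = 0" "\<And>k. k < N \<Longrightarrow> ?f (Suc k) = v $ k"
    using v by (auto simp: zero_extension_def)
  have norm_sq: "(euclidean_norm v)\<^sup>2 = (\<Sum>k<N. (?f (Suc k))\<^sup>2)"
    using v f(3) by (simp add: euclidean_norm_def L2_set_def sum_nonneg)
  have "(\<Sum>k<N. v $ k * w $ k) =
      (\<Sum>k<N. ?f (Suc k) * (?f (Suc (Suc k)) - 2 * ?f (Suc k) + ?f k)) / h\<^sup>2"
    using f(3) v by (simp add: w_def central_difference_mat_mult_vec_index sum_divide_distrib)
  also have "\<dots> = - ?D / h\<^sup>2"
    using f(1,2) by (simp add: summation_by_parts_second_difference)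
  finally have "?D = h\<^sup>2 * - (\<Sum>k<N. v $ k * w $ k)"
    using h by simp
  also have "- (\<Sum>k<N. v $ k * w $ k) \<le> (\<Sum>k<N. \<bar>v $ k\<bar> * \<bar>w $ k\<bar>)"
    unfolding sum_negf[symmetric] by (intro sum_mono) (metis abs_ge_minus_self abs_mult)
  also have "\<dots> \<le> euclidean_norm v * euclidean_norm w"
    using L2_set_mult_ineq[of "\<lambda>k. v $ k" "\<lambda>k. w $ k" "{..<N}"] v dimw
    by (simp add: euclidean_norm_def)
  finally have energy: "?D \<le> h\<^sup>2 * (euclidean_norm v * euclidean_norm w)"
    by (simp add: mult_left_mono)
  have "(euclidean_norm v)\<^sup>2 \<le> (real N + 1)\<^sup>2 * ?D"
    unfolding norm_sq using f(1) by (rule discrete_Poincare)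
  also have "\<dots> \<le> (real N + 1)\<^sup>2 * (h\<^sup>2 * (euclidean_norm v * euclidean_norm w))"
    using energy by (rule mult_left_mono) simp
  also have "\<dots> = euclidean_norm v * (L\<^sup>2 * euclidean_norm w)"
    using hL by (metis mult.assoc mult.left_commute)
  finally have "euclidean_norm v * euclidean_norm v \<le> euclidean_norm v * (L\<^sup>2 * euclidean_norm w)"
    by (simp add: power2_eq_square)
  moreover have "euclidean_norm v \<ge> 0" "euclidean_norm w \<ge> 0"
    by (simp_all add: euclidean_norm_def)
  ultimately have "euclidean_norm v \<le> L\<^sup>2 * euclidean_norm w"
    by (cases "euclidean_norm v = 0") (simp_all add: mult_le_cancel_left)
  then show ?thesis by (simp add: w_def h_def)
qed

lemma euclidean_norm_zero_vec: "euclidean_norm (0\<^sub>v n) = 0"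
  by (simp add: euclidean_norm_def L2_set_def)

lemma euclidean_norm_le_0_imp_zero_vec:
  assumes "euclidean_norm v \<le> 0"
  shows "v = 0\<^sub>v (dim_vec v)"
proof -
  have "euclidean_norm v = 0"
    using assms by (simp add: euclidean_norm_def order_antisym)
  then show ?thesis
    by (intro eq_vecI) (simp_all add: euclidean_norm_def L2_set_eq_0_iff)
qed

text \<open>
  An a-priori estimate on a square matrix yields existence and boundedness of the inverse together:
  in finite dimension the injectivity that it implies is already invertibility.
\<close>

lemma mat_inverse_spectral_norm_le:
  fixes A :: "real mat"
  assumes A: "A \<in> carrier_mat n n"
    and bound: "\<And>v. v \<in> carrier_vec n \<Longrightarrow> euclidean_norm v \<le> K * euclidean_norm (A *\<^sub>v v)"
    and K: "K \<ge> 0"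
  shows "\<exists>E. mat_inverse A = Some E \<and> spectral_norm E \<le> K"
proof -
  have "det A \<noteq> 0"
  proof
    assume "det A = 0"
    then obtain v where v: "v \<in> carrier_vec n" "v \<noteq> 0\<^sub>v n" "A *\<^sub>v v = 0\<^sub>v n"
      using det_0_iff_vec_prod_zero_field[OF A] by blast
    then have "euclidean_norm v \<le> 0"
      using bound[of v] by (simp add: euclidean_norm_zero_vec)
    then show False
      using v euclidean_norm_le_0_imp_zero_vec[of v] by auto
  qed
  then have "mat_inverse A \<noteq> None"
    using mat_inverse(1)[OF A, where b = "()"] det_non_zero_imp_unit[OF A, where b = "()"] by blast
  then obtain E where E: "mat_inverse A = Some E" by auto
  then have AE: "A * E = 1\<^sub>m n" and Ec: "E \<in> carrier_mat n n"
    using mat_inverse(2)[OF A] by auto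
  have "spectral_norm E \<le> K"
    unfolding spectral_norm_def
  proof (rule cSUP_least)
    have "0\<^sub>v n \<in> {v \<in> carrier_vec (dim_col E). euclidean_norm v \<le> 1}"
      using Ec by (simp add: euclidean_norm_zero_vec)
    then show "{v \<in> carrier_vec (dim_col E). euclidean_norm v \<le> 1} \<noteq> {}" by blast
  next
    fix w assume "w \<in> {v \<in> carrier_vec (dim_col E). euclidean_norm v \<le> 1}"
    then have w: "w \<in> carrier_vec n" "euclidean_norm w \<le> 1" using Ec by auto
    have "A *\<^sub>v (E *\<^sub>v w) = w"
      using A Ec w(1) AE by (metis assoc_mult_mat_vec one_mult_mat_vec)
    then have "euclidean_norm (E *\<^sub>v w) \<le> K * euclidean_norm w"
      using bound[of "E *\<^sub>v w"] Ec w(1) by simp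
    also have "\<dots> \<le> K"
      using w(2) K by (simp add: mult_left_le)
    finally show "euclidean_norm (E *\<^sub>v w) \<le> K" .
  qed
  with E show ?thesis by blast
qed

theorem mainTheorem4:
  fixes L :: real
  assumes "L > 0"
  shows "\<exists>K::real. \<forall>N::nat. N > 2 \<longrightarrow>
    (\<exists>E. mat_inverse (central_difference_mat (L / (real N + 1)) N) = Some E \<and>
         spectral_norm E \<le> K)"
proof (intro exI[of _ "L\<^sup>2"] allI impI)
  fix N :: nat
  show "\<exists>E. mat_inverse (central_difference_mat (L / (real N + 1)) N) = Some E \<and>
      spectral_norm E \<le> L\<^sup>2"
    using euclidean_norm_le_central_difference[OF assms]
    by (intro mat_inverse_spectral_norm_le) (auto simp: central_difference_mat_def)
qed

end
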